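(* For every $\mathcal{I}\in\mathsf{FCons}(\mathbb{Z})$, every $k\in\mathbb{N}$, all data words $w_0,w_1$ and positions $i_0,i_1\in\mathbb{N}$: $(w_0,i_0)$ and $(w_1,i_1)$ satisfy exactly the same formulas of $\mathrm{MTL}^{\mathcal{I}}_k$ if and only if Duplicator has a winning strategy in the game $\mathrm{MG}^{\mathcal{I}}_k(w_0,i_0,w_1,i_1)$.
   Context: Data words: infinite sequences $w=(P_0,d_0)(P_1,d_1)\dots$, $P_i\subseteq\mathcal{P}$ ($\mathcal{P}$ a finite set of propositions), $d_i\in\mathbb{N}$; write $P^w_i,d^w_i$. MTL formulas: $\varphi::=p\mid\neg\varphi\mid\varphi_1\wedge\varphi_2\mid\varphi_1\mathsf{U}_I\varphi_2$ where $I$ is an integer interval with endpoints in $\mathbb{Z}\cup\{\pm\infty\}$; $(w,i)\models p$ iff $p\in P_i$, $(w,i)\models\varphi_1\mathsf{U}_I\varphi_2$ iff there is $j>i$ with $(w,j)\models\varphi_2$, $d_j-d_i\in I$, and $(w,k)\models\varphi_1$ for all $i<k<j$. Until rank: $\mathrm{urk}(p)=0$, $\mathrm{urk}(\neg\varphi)=\mathrm{urk}(\varphi)$, $\mathrm{urk}(\varphi_1\wedge\varphi_2)=\max$, $\mathrm{urk}(\varphi_1\mathsf{U}_I\varphi_2)=\max(\mathrm{urk}\varphi_1,\mathrm{urk}\varphi_2)+1$. $\mathsf{FCons}(\mathbb{Z})$ is the family of sets $S\cup\{-\infty,+\infty\}$ with $S\subseteq\mathbb{Z}$ finite. $\mathrm{MTL}^{\mathcal{I}}_k$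 is the set of MTL formulas of until rank $\le k$ all of whose interval endpoints lie in $\mathcal{I}$. Regions: $m,n\in\mathbb{Z}$ are in the same region w.r.t. $\mathcal{I}$ if either $m=n\in\mathcal{I}$, or $m,n\notin\mathcal{I}$ and they lie strictly between the same two consecutive elements of $\mathcal{I}$. Positions $i_0$ of $w_0$ and $i_1$ of $w_1$ agree in the propositional variables if $P^{w_0}_{i_0}=P^{w_1}_{i_1}$. Game $\mathrm{MG}^{\mathcal{I}}_k(w_0,i_0,w_1,i_1)$: if $k=0$, Spoiler wins iff $i_0,i_1$ do not agree in the propositional variables, otherwise Duplicator wins. If $k>0$: (1) if $i_0,i_1$ do not agree in the propositional variables Spoiler wins; otherwise Spoiler picks $l\in\{0,1\}$ and a position $i'_l>i_l$ in $w_l$. (2) Duplicator picks $i'_{1-l}>i_{1-l}$ in $w_{1-l}$; Spoiler wins unless $i'_0,i'_1$ agree in the propositional variables and $d^{w_0}_{i'_0}-d^{w_0}_{i_0}$ and $d^{w_1}_{i'_1}-d^{w_1}_{i_1}$ are in the same region w.r.t. $\mathcal{I}$. (3) Spoiler either continues with $\mathrm{MG}^{\mathcal{I}}_{k-1}(w_0,i'_0,w_1,i'_1)$, or (4) picks $i''_{1-l}$ with $i_{1-l}<i''_{1-l}<i'_{1-l}$, and Duplicator must pick $i''_l$ with $i_l<i''_l<i'_l$ such that $i''_0,i''_1$ agree in the propositional variables, else Spoiler wins; then (5) play continues with $\mathrm{MG}^{\mathcal{I}}_{k-1}(w_0,i''_0,w_1,i''_1)$. Duplicator has a winning strategy if she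 can avoid Spoiler winning in every round whatever Spoiler does. *)

theory Defs
  imports Main "HOL-Library.Extended"
begin

type_synonym 'p data_word = "nat \<Rightarrow> 'p set \<times> nat"

definition props :: "'p data_word \<Rightarrow> nat \<Rightarrow> 'p set" where
  "props w i = fst (w i)"

definition datum :: "'p data_word \<Rightarrow> nat \<Rightarrow> nat" where
  "datum w i = snd (w i)"

definition datum_diff :: "'p data_word \<Rightarrow> nat \<Rightarrow> nat \<Rightarrow> int" where
  "datum_diff w i j = int (datum w j) - int (datum w i)"

text \<open>Intervals are kept syntactic: as sets of integers, the closed interval from 1 to 2 and the
  open interval from 0 to 3 coincide, but only the written endpoints decide whether a formula
  belongs to a fragment of MTL. An infinite endpoint means the same whether it is included or not.\<close>

datatype interval =
    Closed "int extended" "int extended"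
  | Open "int extended" "int extended"
  | Left_Open "int extended" "int extended"
  | Right_Open "int extended" "int extended"

fun ints_in :: "interval \<Rightarrow> int set" where
  "ints_in (Closed a b) = {x. Fin x \<in> {a..b}}"
| "ints_in (Open a b) = {x. Fin x \<in> {a<..<b}}"
| "ints_in (Left_Open a b) = {x. Fin x \<in> {a<..b}}"
| "ints_in (Right_Open a b) = {x. Fin x \<in> {a..<b}}"

fun endpoints :: "interval \<Rightarrow> int extended set" where
  "endpoints (Closed a b) = {a, b}"
| "endpoints (Open a b) = {a, b}"
| "endpoints (Left_Open a b) = {a, b}"
| "endpoints (Right_Open a b) = {a, b}"

datatype 'p mtl =
    Prop 'p
  | Neg "'p mtl"
  | Conj "'p mtl" "'p mtl"
  | Until "'p mtl" interval "'p mtl"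

fun sat :: "'p data_word \<Rightarrow> nat \<Rightarrow> 'p mtl \<Rightarrow> bool" where
  "sat w i (Prop p) \<longleftrightarrow> p \<in> props w i"
| "sat w i (Neg \<phi>) \<longleftrightarrow> \<not> sat w i \<phi>"
| "sat w i (Conj \<phi> \<psi>) \<longleftrightarrow> sat w i \<phi> \<and> sat w i \<psi>"
| "sat w i (Until \<phi> I \<psi>) \<longleftrightarrow>
     (\<exists>j>i. sat w j \<psi> \<and> datum_diff w i j \<in> ints_in I \<and> (\<forall>k. i < k \<and> k < j \<longrightarrow> sat w k \<phi>))"

fun urk :: "'p mtl \<Rightarrow> nat" where
  "urk (Prop p) = 0"
| "urk (Neg \<phi>) = urk \<phi>"
| "urk (Conj \<phi> \<psi>) = max (urk \<phi>) (urk \<psi>)"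
| "urk (Until \<phi> I \<psi>) = max (urk \<phi>) (urk \<psi>) + 1"

fun mtl_endpoints :: "'p mtl \<Rightarrow> int extended set" where
  "mtl_endpoints (Prop p) = {}"
| "mtl_endpoints (Neg \<phi>) = mtl_endpoints \<phi>"
| "mtl_endpoints (Conj \<phi> \<psi>) = mtl_endpoints \<phi> \<union> mtl_endpoints \<psi>"
| "mtl_endpoints (Until \<phi> I \<psi>) = mtl_endpoints \<phi> \<union> endpoints I \<union> mtl_endpoints \<psi>"

definition FCons :: "int extended set set" where
  "FCons = {Fin ` S \<union> {Minf, Pinf} | S. finite S}"

definition MTL :: "int extended set \<Rightarrow> nat \<Rightarrow> 'p mtl set" where
  "MTL \<I> k = {\<phi>. urk \<phi> \<le> k \<and> mtl_endpoints \<phi> \<subseteq> \<I>}"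

definition consecutive :: "int extended set \<Rightarrow> int extended \<Rightarrow> int extended \<Rightarrow> bool" where
  "consecutive \<I> a b \<longleftrightarrow> a \<in> \<I> \<and> b \<in> \<I> \<and> a < b \<and> \<not> (\<exists>c\<in>\<I>. a < c \<and> c < b)"

definition same_region :: "int extended set \<Rightarrow> int \<Rightarrow> int \<Rightarrow> bool" where
  "same_region \<I> m n \<longleftrightarrow>
     (m = n \<and> Fin m \<in> \<I>) \<or>
     (Fin m \<notin> \<I> \<and> Fin n \<notin> \<I> \<and>
      (\<exists>a b. consecutive \<I> a b \<and> Fin m \<in> {a<..<b} \<and> Fin n \<in> {a<..<b}))"

text \<open>In the game, the two words and the positions marked in them are families indexed by
  \<^typ>\<open>bool\<close>, with index \<^term>\<open>False\<close> for 0 and \<^term>\<open>True\<close> for 1, so that the index $1-l$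
  is \<^term>\<open>\<not> l\<close>.\<close>

definition agree :: "(bool \<Rightarrow> 'p data_word) \<Rightarrow> (bool \<Rightarrow> nat) \<Rightarrow> bool" where
  "agree w i \<longleftrightarrow> props (w False) (i False) = props (w True) (i True)"

text \<open>
  \<^item> \<open>Round k i\<close>: the game with \<open>k\<close> rounds starts at the positions \<open>i\<close>.
  \<^item> \<open>Picked k i l m\<close>: Spoiler has picked the position \<open>m\<close> in word \<open>l\<close>, and \<open>k\<close> rounds remain after
    this one; Duplicator is to answer in word \<open>\<not> l\<close>.
  \<^item> \<open>Answered k i l i'\<close>: Duplicator has answered, so that the new positions are \<open>i'\<close>; Spoiler is to
    continue from \<open>i'\<close> or to pick a position strictly between \<open>i\<close> and \<open>i'\<close> in word \<open>\<not> l\<close>.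
  \<^item> \<open>Inner k i l i' m\<close>: Spoiler has picked such a position \<open>m\<close>; Duplicator is to answer in word \<open>l\<close>.
\<close>

datatype config =
    Round nat "bool \<Rightarrow> nat"
  | Picked nat "bool \<Rightarrow> nat" bool nat
  | Answered nat "bool \<Rightarrow> nat" bool "bool \<Rightarrow> nat"
  | Inner nat "bool \<Rightarrow> nat" bool "bool \<Rightarrow> nat" nat

inductive spoiler_move :: "(bool \<Rightarrow> 'p data_word) \<Rightarrow> config \<Rightarrow> config \<Rightarrow> bool"
  for w :: "bool \<Rightarrow> 'p data_word" where
  pick: "agree w i \<Longrightarrow> i l < m \<Longrightarrow> spoiler_move w (Round (Suc k) i) (Picked k i l m)"
| continue: "spoiler_move w (Answered k i l i') (Round k i')"
| pick_inner: "i (\<not> l) < m \<Longrightarrow> m < i' (\<not> l) \<Longrightarrow>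
    spoiler_move w (Answered k i l i') (Inner k i l i' m)"

text \<open>Only the moves of Duplicator with which she does not lose immediately.\<close>

inductive duplicator_move ::
    "int extended set \<Rightarrow> (bool \<Rightarrow> 'p data_word) \<Rightarrow> config \<Rightarrow> config \<Rightarrow> bool"
  for \<I> :: "int extended set" and w :: "bool \<Rightarrow> 'p data_word" where
  answer: "i' l = m \<Longrightarrow> i (\<not> l) < i' (\<not> l) \<Longrightarrow> agree w i' \<Longrightarrow>
    same_region \<I> (datum_diff (w False) (i False) (i' False))
                   (datum_diff (w True) (i True) (i' True)) \<Longrightarrow>
    duplicator_move \<I> w (Picked k i l m) (Answered k i l i')"
| answer_inner: "i'' (\<not> l) = m \<Longrightarrow> i l < i'' l \<Longrightarrow> i'' l < i' l \<Longrightarrow> agree w i'' \<Longrightarrow>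
    duplicator_move \<I> w (Inner k i l i' m) (Round k i'')"

fun duplicator_turn :: "config \<Rightarrow> bool" where
  "duplicator_turn (Round k i) = False"
| "duplicator_turn (Picked k i l m) = True"
| "duplicator_turn (Answered k i l i') = False"
| "duplicator_turn (Inner k i l i' m) = True"

text \<open>A strategy of Duplicator maps the history of the play, latest configuration first, to the
  configuration she moves to.\<close>

type_synonym strategy = "config list \<Rightarrow> config"

inductive play ::
    "int extended set \<Rightarrow> (bool \<Rightarrow> 'p data_word) \<Rightarrow> strategy \<Rightarrow> config \<Rightarrow> config list \<Rightarrow> bool"
  for \<I> :: "int extended set" and w :: "bool \<Rightarrow> 'p data_word"
    and \<sigma> :: strategy and c\<^sub>0 :: config where
  init: "play \<I> w \<sigma> c\<^sub>0 [c\<^sub>0]"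
| spoiler: "play \<I> w \<sigma> c\<^sub>0 (c # h) \<Longrightarrow> spoiler_move w c c' \<Longrightarrow> play \<I> w \<sigma> c\<^sub>0 (c' # c # h)"
| duplicator: "play \<I> w \<sigma> c\<^sub>0 (c # h) \<Longrightarrow> duplicator_move \<I> w c (\<sigma> (c # h)) \<Longrightarrow>
    play \<I> w \<sigma> c\<^sub>0 (\<sigma> (c # h) # c # h)"

fun spoiler_wins_at ::
    "int extended set \<Rightarrow> (bool \<Rightarrow> 'p data_word) \<Rightarrow> strategy \<Rightarrow> config list \<Rightarrow> bool" where
  "spoiler_wins_at \<I> w \<sigma> [] = False"
| "spoiler_wins_at \<I> w \<sigma> (c # h) \<longleftrightarrow>
     (\<exists>k i. c = Round k i \<and> \<not> agree w i) \<or>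
     (duplicator_turn c \<and> \<not> duplicator_move \<I> w c (\<sigma> (c # h)))"

text \<open>Every play ends after at most \<open>k\<close> rounds, and Spoiler can always move as long as a round is
  left, so Duplicator wins a play iff Spoiler does not win it at any point.\<close>

definition winning_strategy ::
    "int extended set \<Rightarrow> (bool \<Rightarrow> 'p data_word) \<Rightarrow> config \<Rightarrow> strategy \<Rightarrow> bool" where
  "winning_strategy \<I> w c\<^sub>0 \<sigma> \<longleftrightarrow>
     (\<forall>h. play \<I> w \<sigma> c\<^sub>0 h \<longrightarrow> \<not> spoiler_wins_at \<I> w \<sigma> h)"

definition duplicator_wins_MG ::
    "int extended set \<Rightarrow> nat \<Rightarrow> 'p data_word \<Rightarrow> nat \<Rightarrow> 'p data_word \<Rightarrow> nat \<Rightarrow> bool" where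
  "duplicator_wins_MG \<I> k w\<^sub>0 i\<^sub>0 w\<^sub>1 i\<^sub>1 \<longleftrightarrow>
     (\<exists>\<sigma>. winning_strategy \<I> (\<lambda>l. if l then w\<^sub>1 else w\<^sub>0) (Round k (\<lambda>l. if l then i\<^sub>1 else i\<^sub>0)) \<sigma>)"

end

theory Submission
  imports Defs
begin

text \<open>Duplicator wins iff the initial configuration lies in the greatest set of configurations in
  which Spoiler has not won and which Duplicator can avoid leaving; this reduces strategies to a
  recursive condition on the number of rounds. Given that condition, a formula
  $\varphi_1\mathsf{U}_I\varphi_2$ is transferred from one word to the other by letting Spoiler pick
  its witness, and then any position of the other word at which $\varphi_1$ could fail.
  Conversely, $\mathrm{MTL}^{\mathcal{I}}_k$ is finite up to equivalence, so the $k$-type of a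
  position is defined by a formula of rank $k$. If Spoiler picks $m > i$, Duplicator finds her answer
  from the formula $\varphi_1\mathsf{U}_I\varphi_2$ of rank $k+1$, where $\varphi_2$ is the $k$-type of
  $m$, $\varphi_1$ is the disjunction of the $k$-types of the positions between $i$ and $m$, and $I$ is
  the region of the difference of the data values.\<close>

section \<open>Winning strategies as a greatest fixed point\<close>

text \<open>Being the greatest such set, \<open>safe\<close> contains every set of configurations
  closed under its conditions, in particular those reached while following a winning
  strategy.\<close>

coinductive safe :: "int extended set \<Rightarrow> (bool \<Rightarrow> 'p data_word) \<Rightarrow> config \<Rightarrow> bool"
  for \<I> :: "int extended set" and w :: "bool \<Rightarrow> 'p data_word" where
  "(\<And>k i. c = Round k i \<Longrightarrow> agree w i) \<Longrightarrow>
   (\<And>c'. spoiler_move w c c' \<Longrightarrow> safe \<I> w c') \<Longrightarrow>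
   (duplicator_turn c \<Longrightarrow> \<exists>c'. duplicator_move \<I> w c c' \<and> safe \<I> w c') \<Longrightarrow>
   safe \<I> w c"

lemma duplicator_move_turn: "duplicator_move \<I> w c c' \<Longrightarrow> duplicator_turn c"
  by (induction rule: duplicator_move.induct) auto

text \<open>From left to right, the configurations reached under a winning \<open>\<sigma>\<close>
  form a post-fixed point, so coinduction applies. From right to left, always moving to some safe
  configuration keeps every play inside \<open>safe\<close>.\<close>

lemma ex_winning_strategy_iff_safe: "(\<exists>\<sigma>. winning_strategy \<I> w c \<sigma>) \<longleftrightarrow> safe \<I> w c"
proof
  assume "\<exists>\<sigma>. winning_strategy \<I> w c \<sigma>"
  then obtain \<sigma> where win: "\<And>h. play \<I> w \<sigma> c h \<Longrightarrow> \<not> spoiler_wins_at \<I> w \<sigma> h"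
    unfolding winning_strategy_def by blast
  have "safe \<I> w d" if "\<exists>h. play \<I> w \<sigma> c (d # h)" for d
    using that
  proof (coinduction arbitrary: d rule: safe.coinduct)
    case safe
    then obtain h where h: "play \<I> w \<sigma> c (d # h)" by blast
    have "duplicator_move \<I> w d (\<sigma> (d # h))" if "duplicator_turn d"
      using win[OF h] that by simp
    then show ?case using h win[OF h] by (auto intro: play.spoiler play.duplicator)
  qed
  then show "safe \<I> w c" by (blast intro: play.init)
next
  assume safe: "safe \<I> w c"
  \<comment> \<open>A positional strategy: only the current configuration \<open>hd h\<close> is
    consulted.\<close>
  define \<sigma> :: strategy where
    "\<sigma> h = (SOME c'. duplicator_move \<I> w (hd h) c' \<and> safe \<I> w c')" for h
  have \<sigma>: "duplicator_move \<I> w d (\<sigma> (d # h)) \<and> safe \<I> w (\<sigma> (d # h))"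
    if "safe \<I> w d" "duplicator_turn d" for d h
  proof -
    have "\<exists>c'. duplicator_move \<I> w d c' \<and> safe \<I> w c'"
      using that by (auto elim: safe.cases)
    then show ?thesis unfolding \<sigma>_def by (simp only: list.sel) (rule someI_ex)
  qed
  have "safe \<I> w (hd h) \<and> h \<noteq> []" if "play \<I> w \<sigma> c h" for h
    using that
  proof induction
    case init
    then show ?case using safe by simp
  next
    case (spoiler d h c')
    then show ?case by (auto elim: safe.cases)
  next
    case (duplicator d h)
    then show ?case using \<sigma> duplicator_move_turn by fastforce
  qed
  moreover have "\<not> spoiler_wins_at \<I> w \<sigma> (d # h)" if "safe \<I> w d" for d h
    using that \<sigma>[OF that] by (auto elim: safe.cases)
  ultimately have "winning_strategy \<I> w c \<sigma>"
    unfolding winning_strategy_def by (metis list.collapse)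
  then show "\<exists>\<sigma>. winning_strategy \<I> w c \<sigma>" by blast
qed

section \<open>Unfolding safety phase by phase within a round\<close>

lemma safe_Round_0: "safe \<I> w (Round 0 i) \<longleftrightarrow> agree w i"
  by (subst safe.simps) (auto elim: spoiler_move.cases)

lemma safe_Round_agree: "safe \<I> w (Round k i) \<Longrightarrow> agree w i"
  by (auto elim: safe.cases)

text \<open>The condition \<open>agree w i''\<close> on Duplicator's move is absorbed by the safety
  of the next \<open>Round\<close>.\<close>

lemma safe_Inner:
  "safe \<I> w (Inner k i l i' m) \<longleftrightarrow>
    (\<exists>i''. i'' (\<not> l) = m \<and> i l < i'' l \<and> i'' l < i' l \<and> safe \<I> w (Round k i''))"
  by (subst safe.simps)
    (auto elim!: spoiler_move.cases duplicator_move.cases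
      intro: duplicator_move.answer_inner safe_Round_agree)

lemma safe_Answered:
  "safe \<I> w (Answered k i l i') \<longleftrightarrow>
    safe \<I> w (Round k i') \<and> (\<forall>m. i (\<not> l) < m \<and> m < i' (\<not> l) \<longrightarrow> safe \<I> w (Inner k i l i' m))"
  by (subst safe.simps) (auto elim!: spoiler_move.cases intro: spoiler_move.intros)

lemma safe_Picked:
  "safe \<I> w (Picked k i l m) \<longleftrightarrow>
    (\<exists>i'. i' l = m \<and> i (\<not> l) < i' (\<not> l) \<and>
      same_region \<I> (datum_diff (w False) (i False) (i' False))
        (datum_diff (w True) (i True) (i' True)) \<and>
      safe \<I> w (Answered k i l i'))"
  by (subst safe.simps)
    (auto elim!: spoiler_move.cases duplicator_move.cases
      intro: duplicator_move.answer dest: safe_Answered[THEN iffD1] safe_Round_agree)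

lemma safe_Round_Suc:
  "safe \<I> w (Round (Suc k) i) \<longleftrightarrow>
    agree w i \<and> (\<forall>l m. i l < m \<longrightarrow> safe \<I> w (Picked k i l m))"
  by (subst safe.simps) (auto elim!: spoiler_move.cases intro: spoiler_move.intros)

section \<open>Regions and intervals\<close>

lemma same_region_sym: "same_region \<I> m n \<Longrightarrow> same_region \<I> n m"
  unfolding same_region_def by blast

text \<open>Lets both choices of the word \<open>l\<close> by Spoiler be treated at once.\<close>

lemma same_region_bool:
  "same_region \<I> (f False) (f True) \<longleftrightarrow> same_region \<I> (f l) (f (\<not> l))"
  by (cases l) (auto intro: same_region_sym)

text \<open>The two integers are equal or lie in a common gap between consecutive elements of
  \<open>\<I>\<close>, and \<open>a\<close> cannot lie inside that gap.\<close>

lemma same_region_cut: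
  assumes "same_region \<I> m n" "a \<in> \<I>"
  shows "a \<le> Fin m \<longleftrightarrow> a \<le> Fin n" "a < Fin m \<longleftrightarrow> a < Fin n"
    "Fin m \<le> a \<longleftrightarrow> Fin n \<le> a" "Fin m < a \<longleftrightarrow> Fin n < a"
proof -
  have *: "a < Fin m \<and> a < Fin n \<or> a > Fin m \<and> a > Fin n"
    if "Fin m \<notin> \<I>" "consecutive \<I> b c" "Fin m \<in> {b<..<c}" "Fin n \<in> {b<..<c}" for b c
  proof -
    have "a \<le> b \<or> c \<le> a" using that assms(2) unfolding consecutive_def by (meson not_le)
    then show ?thesis using that by auto
  qed
  have "m = n \<or> a < Fin m \<and> a < Fin n \<or> a > Fin m \<and> a > Fin n"
    using assms(1) * unfolding same_region_def by blast
  then show "a \<le> Fin m \<longleftrightarrow> a \<le> Fin n" "a < Fin m \<longleftrightarrow> a < Fin n"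
    "Fin m \<le> a \<longleftrightarrow> Fin n \<le> a" "Fin m < a \<longleftrightarrow> Fin n < a"
    by auto
qed

lemma same_region_ints_in:
  assumes "same_region \<I> m n" "endpoints J \<subseteq> \<I>"
  shows "m \<in> ints_in J \<longleftrightarrow> n \<in> ints_in J"
  using assms(2) by (cases J) (auto simp: same_region_cut[OF assms(1)])

text \<open>The region of \<open>d\<close> can be expressed by an interval of the fragment: the
  singleton of \<open>d\<close> if \<open>d\<close> is a constant of \<open>\<I>\<close>, otherwise
  the open interval between its neighbours.\<close>

lemma ex_region_interval:
  assumes "\<I> \<in> FCons"
  obtains J where "endpoints J \<subseteq> \<I>" "d \<in> ints_in J"
    "\<And>e. e \<in> ints_in J \<Longrightarrow> same_region \<I> d e"
proof (cases "Fin d \<in> \<I>")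
  case True
  then show thesis by (intro that[of "Closed (Fin d) (Fin d)"]) (auto simp: same_region_def)
next
  case False
  have fin: "finite \<I>" and inf: "Minf \<in> \<I>" "Pinf \<in> \<I>"
    using assms unfolding FCons_def by auto
  \<comment> \<open>\<open>Minf\<close> and \<open>Pinf\<close> make both sets nonempty, and
    finiteness of \<open>\<I>\<close> then gives the nearest elements on either side of
    \<open>d\<close>.\<close>
  define A where "A = {x \<in> \<I>. x < Fin d}"
  define B where "B = {x \<in> \<I>. Fin d < x}"
  have "finite A" "A \<noteq> {}" "finite B" "B \<noteq> {}"
    using fin inf unfolding A_def B_def by auto
  then have A: "Max A \<in> A" "\<And>x. x \<in> A \<Longrightarrow> x \<le> Max A"
    and B: "Min B \<in> B" "\<And>x. x \<in> B \<Longrightarrow> Min B \<le> x"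
    by auto
  have d: "Max A < Fin d" "Fin d < Min B" and mem: "Max A \<in> \<I>" "Min B \<in> \<I>"
    using A(1) B(1) unfolding A_def B_def by auto
  have gap: "\<not> (\<exists>c\<in>\<I>. Max A < c \<and> c < Min B)"
  proof
    assume "\<exists>c\<in>\<I>. Max A < c \<and> c < Min B"
    then obtain c where c: "c \<in> \<I>" "Max A < c" "c < Min B" by blast
    then have "c \<notin> A" "c \<notin> B" using A(2) B(2) by (auto simp: not_less[symmetric])
    then have "c = Fin d" using c(1) unfolding A_def B_def by auto
    then show False using c(1) False by simp
  qed
  then have cons: "consecutive \<I> (Max A) (Min B)"
    using d mem unfolding consecutive_def by auto
  show thesis
  proof (rule that[of "Open (Max A) (Min B)"])
    fix e assume "e \<in> ints_in (Open (Max A) (Min B))"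
    then have e: "Fin e \<in> {Max A<..<Min B}" by simp
    then have "Fin e \<notin> \<I>" using gap by auto
    then show "same_region \<I> d e" using False cons d e unfolding same_region_def by auto
  qed (use d mem in auto)
qed

lemma finite_intervals:
  assumes "finite \<I>"
  shows "finite {J. endpoints J \<subseteq> \<I>}"
proof (rule finite_subset)
  show "{J. endpoints J \<subseteq> \<I>} \<subseteq> (\<lambda>(f, a, b). f a b) `
      ({Closed, Open, Left_Open, Right_Open} \<times> \<I> \<times> \<I>)"
  proof
    fix J assume "J \<in> {J. endpoints J \<subseteq> \<I>}"
    then show "J \<in> (\<lambda>(f, a, b). f a b) ` ({Closed, Open, Left_Open, Right_Open} \<times> \<I> \<times> \<I>)"
      by (cases J) (force simp: image_iff)+
  qed
qed (use assms in auto)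

section \<open>Finiteness up to equivalence and type formulas\<close>

text \<open>Turns finiteness up to equivalence into finiteness of an image of
  \<open>models\<close>.\<close>

definition models :: "'p mtl \<Rightarrow> ('p data_word \<times> nat) set" where
  "models \<phi> = {(w, i). sat w i \<phi>}"

text \<open>The until operator on sets of pointed words; an until formula depends on its arguments
  only through their models.\<close>

definition until_models ::
    "('p data_word \<times> nat) set \<Rightarrow> interval \<Rightarrow> ('p data_word \<times> nat) set \<Rightarrow> ('p data_word \<times> nat) set"
  where "until_models A J B =
    {(w, i). \<exists>j>i. (w, j) \<in> B \<and> datum_diff w i j \<in> ints_in J \<and> (\<forall>k. i < k \<and> k < j \<longrightarrow> (w, k) \<in> A)}"

lemma models_Until: "models (Until \<phi> J \<psi>) = until_models (models \<phi>) J (models \<psi>)"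
  by (auto simp: models_def until_models_def)

definition boolean_combinations :: "'a set set \<Rightarrow> 'a set set" where
  "boolean_combinations B = (\<lambda>T. {x. {b \<in> B. x \<in> b} \<in> T}) ` Pow (Pow B)"

lemma finite_boolean_combinations: "finite B \<Longrightarrow> finite (boolean_combinations B)"
  unfolding boolean_combinations_def by simp

lemma boolean_combinations_base:
  assumes "b \<in> B"
  shows "b \<in> boolean_combinations B"
  unfolding boolean_combinations_def
  by (rule image_eqI[of _ _ "{X \<in> Pow B. b \<in> X}"]) (use assms in auto)

lemma boolean_combinations_Compl:
  assumes "X \<in> boolean_combinations B"
  shows "- X \<in> boolean_combinations B"
proof -
  obtain T where "X = {x. {b \<in> B. x \<in> b} \<in> T}"
    using assms unfolding boolean_combinations_def by auto
  then show ?thesis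
    unfolding boolean_combinations_def by (intro image_eqI[of _ _ "Pow B - T"]) auto
qed

lemma boolean_combinations_Int:
  assumes "X \<in> boolean_combinations B" "Y \<in> boolean_combinations B"
  shows "X \<inter> Y \<in> boolean_combinations B"
proof -
  obtain S T where "X = {x. {b \<in> B. x \<in> b} \<in> S}" "Y = {x. {b \<in> B. x \<in> b} \<in> T}"
      "S \<subseteq> Pow B"
    using assms unfolding boolean_combinations_def by auto
  then show ?thesis
    unfolding boolean_combinations_def by (intro image_eqI[of _ _ "S \<inter> T"]) auto
qed

text \<open>Outermost until subformulas are treated as atoms, since the Boolean connectives keep a
  formula and its parts in the same fragment.\<close>

lemma models_boolean_combination:
  assumes "\<phi> \<in> MTL \<I> k" "range (models \<circ> Prop) \<subseteq> B"
    and "\<And>\<alpha> J \<beta>. Until \<alpha> J \<beta> \<in> MTL \<I> k \<Longrightarrow> models (Until \<alpha> J \<beta>) \<in> B"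
  shows "models \<phi> \<in> boolean_combinations B"
  using assms(1)
proof (induction \<phi>)
  case (Prop p)
  then show ?case using assms(2) by (auto intro: boolean_combinations_base)
next
  case (Neg \<phi>)
  moreover have "models (Neg \<phi>) = - models \<phi>" by (auto simp: models_def)
  ultimately show ?case by (simp add: MTL_def boolean_combinations_Compl)
next
  case (Conj \<phi> \<psi>)
  moreover have "models (Conj \<phi> \<psi>) = models \<phi> \<inter> models \<psi>" by (auto simp: models_def)
  ultimately show ?case by (simp add: MTL_def boolean_combinations_Int)
next
  case (Until \<phi> J \<psi>)
  then show ?case by (intro boolean_combinations_base assms(3))
qed

text \<open>Until formulas of rank at most \<open>Suc k\<close> have arguments in
  \<open>MTL \<I> k\<close>, which have finitely many models by induction. With finitely many
  intervals and propositions, the generators are finite in number.\<close>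

lemma finite_models_MTL:
  assumes "finite \<I>"
  shows "finite (models ` (MTL \<I> k :: 'p::finite mtl set))"
proof (induction k)
  case 0
  have "models ` MTL \<I> 0 \<subseteq> boolean_combinations (range (models \<circ> (Prop :: 'p \<Rightarrow> 'p mtl)))"
    by (intro image_subsetI models_boolean_combination[of _ \<I> 0]) (auto simp: MTL_def)
  then show ?case by (rule finite_subset) (simp add: finite_boolean_combinations)
next
  case (Suc k)
  let ?M = "models ` (MTL \<I> k :: 'p mtl set)"
  let ?B = "range (models \<circ> (Prop :: 'p \<Rightarrow> 'p mtl)) \<union>
    (\<lambda>(A, J, B). until_models A J B) ` (?M \<times> {J. endpoints J \<subseteq> \<I>} \<times> ?M)"
  have "models ` MTL \<I> (Suc k) \<subseteq> boolean_combinations ?B"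
  proof (intro image_subsetI models_boolean_combination[of _ \<I> "Suc k"])
    fix \<alpha> \<beta> :: "'p mtl" and J
    assume "Until \<alpha> J \<beta> \<in> MTL \<I> (Suc k)"
    then have "\<alpha> \<in> MTL \<I> k" "\<beta> \<in> MTL \<I> k" "endpoints J \<subseteq> \<I>" by (auto simp: MTL_def)
    then show "models (Until \<alpha> J \<beta>) \<in> ?B" by (force simp: models_Until)
  qed auto
  moreover have "finite ?B" using Suc finite_intervals[OF assms] by simp
  ultimately show ?case by (blast intro: finite_subset finite_boolean_combinations)
qed

section \<open>Finite conjunctions, disjunctions and type formulas\<close>

lemma ex_big_conj:
  assumes "finite X" "X \<subseteq> MTL \<I> k"
  shows "\<exists>\<chi>\<in>MTL \<I> k. \<forall>w i. sat w i \<chi> \<longleftrightarrow> (\<forall>\<phi>\<in>X. sat w i \<phi>)"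
  using assms
proof (induction X)
  case empty
  show ?case
    \<comment> \<open>The empty conjunction is a tautology over an arbitrary proposition; it has
      rank 0 and no endpoints, so it lies in every fragment.\<close>
    by (rule bexI[of _ "Neg (Conj (Prop undefined) (Neg (Prop undefined)))"]) (auto simp: MTL_def)
next
  case (insert \<phi> X)
  then obtain \<chi> where "\<chi> \<in> MTL \<I> k" "\<forall>w i. sat w i \<chi> \<longleftrightarrow> (\<forall>\<phi>\<in>X. sat w i \<phi>)" by auto
  then show ?case using insert.prems by (intro bexI[of _ "Conj \<phi> \<chi>"]) (auto simp: MTL_def)
qed

lemma ex_big_disj:
  assumes "finite X" "X \<subseteq> MTL \<I> k"
  shows "\<exists>\<chi>\<in>MTL \<I> k. \<forall>w i. sat w i \<chi> \<longleftrightarrow> (\<exists>\<phi>\<in>X. sat w i \<phi>)"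
proof -
  have "Neg ` X \<subseteq> MTL \<I> k" using assms(2) by (fastforce simp: MTL_def)
  from ex_big_conj[OF finite_imageI[OF assms(1)] this] obtain \<chi>
    where "\<chi> \<in> MTL \<I> k" "\<forall>w i. sat w i \<chi> \<longleftrightarrow> (\<forall>\<phi>\<in>Neg ` X. sat w i \<phi>)" by blast
  then show ?thesis by (intro bexI[of _ "Neg \<chi>"]) (auto simp: MTL_def)
qed

definition mtl_equiv ::
    "int extended set \<Rightarrow> nat \<Rightarrow> 'p data_word \<Rightarrow> nat \<Rightarrow> 'p data_word \<Rightarrow> nat \<Rightarrow> bool" where
  "mtl_equiv \<I> k w i w' i' \<longleftrightarrow> (\<forall>\<phi>\<in>MTL \<I> k. sat w i \<phi> \<longleftrightarrow> sat w' i' \<phi>)"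

lemma mtl_equiv_refl: "mtl_equiv \<I> k w i w i"
  by (simp add: mtl_equiv_def)

lemma mtl_equiv_sym: "mtl_equiv \<I> k w i w' i' \<Longrightarrow> mtl_equiv \<I> k w' i' w i"
  by (simp add: mtl_equiv_def)

lemma mtl_equiv_bool:
  "mtl_equiv \<I> k (w False) (i False) (w True) (i True) \<longleftrightarrow>
    mtl_equiv \<I> k (w l) (i l) (w (\<not> l)) (i (\<not> l))"
  by (cases l) (auto intro: mtl_equiv_sym)

text \<open>Finitely many representatives \<open>F\<close> cover the fragment up to equivalence; the
  conjunction of each of them or its negation, according to its truth at \<open>(w, i)\<close>,
  fixes the whole type.\<close>

lemma ex_type_formula:
  fixes w :: "'p::finite data_word"
  assumes "finite \<I>"
  shows "\<exists>\<chi>\<in>MTL \<I> k. \<forall>w' i'. sat w' i' \<chi> \<longleftrightarrow> mtl_equiv \<I> k w i w' i'"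
proof -
  obtain F :: "'p mtl set" where F: "F \<subseteq> MTL \<I> k" "finite F" "models ` MTL \<I> k = models ` F"
    using finite_subset_image[OF finite_models_MTL[OF assms] subset_refl] by metis
  let ?X = "(\<lambda>\<phi>. if sat w i \<phi> then \<phi> else Neg \<phi>) ` F"
  have "finite ?X" using F(2) by simp
  moreover have "?X \<subseteq> MTL \<I> k" using F(1) by (fastforce simp: MTL_def)
  ultimately have "\<exists>\<chi>\<in>MTL \<I> k. \<forall>w' i'. sat w' i' \<chi> \<longleftrightarrow> (\<forall>\<phi>\<in>?X. sat w' i' \<phi>)"
    by (rule ex_big_conj)
  then obtain \<chi> where
    \<chi>: "\<chi> \<in> MTL \<I> k" "\<forall>w' i'. sat w' i' \<chi> \<longleftrightarrow> (\<forall>\<phi>\<in>?X. sat w' i' \<phi>)"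
    by (elim bexE)
  have "mtl_equiv \<I> k w i w' i' \<longleftrightarrow> (\<forall>\<phi>\<in>F. sat w i \<phi> \<longleftrightarrow> sat w' i' \<phi>)" for w' i'
  proof
    assume eq: "\<forall>\<phi>\<in>F. sat w i \<phi> \<longleftrightarrow> sat w' i' \<phi>"
    show "mtl_equiv \<I> k w i w' i'"
      unfolding mtl_equiv_def
    proof
      fix \<phi> :: "'p mtl"
      assume "\<phi> \<in> MTL \<I> k"
      then obtain \<psi> where \<psi>: "\<psi> \<in> F" "models \<phi> = models \<psi>" using F(3) by (metis imageE imageI)
      then have "sat v j \<phi> \<longleftrightarrow> sat v j \<psi>" for v j by (auto simp: models_def set_eq_iff)
      then show "sat w i \<phi> \<longleftrightarrow> sat w' i' \<phi>" using eq \<psi>(1) by simp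
    qed
  qed (use F(1) in \<open>auto simp: mtl_equiv_def\<close>)
  moreover have "sat w' i' \<chi> \<longleftrightarrow> (\<forall>\<phi>\<in>F. sat w i \<phi> \<longleftrightarrow> sat w' i' \<phi>)" for w' i'
  proof -
    have "sat w' i' (if sat w i \<phi> then \<phi> else Neg \<phi>) \<longleftrightarrow> (sat w i \<phi> \<longleftrightarrow> sat w' i' \<phi>)" for \<phi>
      by simp
    then show ?thesis by (simp only: \<chi>(2) ball_simps)
  qed
  ultimately show ?thesis using \<chi>(1) by (intro bexI[of _ \<chi>]) simp_all
qed

section \<open>The game characterises equivalence\<close>

text \<open>One implication suffices because \<open>l\<close> is arbitrary: negation is handled by
  exchanging the words. \<open>k\<close> is generalized since it drops at each until.\<close>

lemma safe_imp_sat: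
  assumes "safe \<I> w (Round k i)" "\<phi> \<in> MTL \<I> k"
  shows "sat (w l) (i l) \<phi> \<Longrightarrow> sat (w (\<not> l)) (i (\<not> l)) \<phi>"
  using assms
proof (induction \<phi> arbitrary: k i l)
  case (Prop p)
  then show ?case using safe_Round_agree[OF Prop.prems(2)] by (cases l) (auto simp: agree_def)
next
  case (Neg \<phi>)
  then show ?case using Neg.IH[of "\<not> l" i k] by (auto simp: MTL_def)
next
  case (Conj \<phi> \<psi>)
  then show ?case by (auto simp: MTL_def)
next
  case (Until \<phi> J \<psi>)
  then obtain k' where k: "k = Suc k'" by (cases k) (auto simp: MTL_def)
  have sub: "\<phi> \<in> MTL \<I> k'" "\<psi> \<in> MTL \<I> k'" "endpoints J \<subseteq> \<I>"
    using Until.prems(3) k by (auto simp: MTL_def)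
  obtain m where m: "i l < m" "sat (w l) m \<psi>" "datum_diff (w l) (i l) m \<in> ints_in J"
    "\<And>n. i l < n \<Longrightarrow> n < m \<Longrightarrow> sat (w l) n \<phi>"
    using Until.prems(1) by auto
  \<comment> \<open>Spoiler picks the witness of the until formula.\<close>
  have "safe \<I> w (Picked k' i l m)" using Until.prems(2) m(1) by (simp add: k safe_Round_Suc)
  then obtain i' where i': "i' l = m" "i (\<not> l) < i' (\<not> l)"
    "same_region \<I> (datum_diff (w l) (i l) (i' l))
        (datum_diff (w (\<not> l)) (i (\<not> l)) (i' (\<not> l)))"
    "safe \<I> w (Answered k' i l i')"
    unfolding safe_Picked same_region_bool[of \<I> "\<lambda>b. datum_diff (w b) (i b) (i' b)" for i', where l=l]
    by blast
  have "sat (w (\<not> l)) (i' (\<not> l)) \<psi>"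
    using Until.IH(2)[of l i' k'] m(2) i' sub by (simp add: safe_Answered)
  moreover have "datum_diff (w (\<not> l)) (i (\<not> l)) (i' (\<not> l)) \<in> ints_in J"
    using same_region_ints_in[OF i'(3) sub(3)] m(3) i'(1) by simp
  moreover have "sat (w (\<not> l)) n \<phi>" if n: "i (\<not> l) < n" "n < i' (\<not> l)" for n
  proof -
    \<comment> \<open>Spoiler challenges with \<open>n\<close>; Duplicator's reply lies strictly
      between \<open>i l\<close> and \<open>m\<close>, where \<open>\<phi>\<close> holds, and the
      induction hypothesis carries \<open>\<phi>\<close> back to \<open>n\<close>.\<close>
    obtain i'' where "i'' (\<not> l) = n" "i l < i'' l" "i'' l < i' l" "safe \<I> w (Round k' i'')"
      using i'(4) n by (auto simp: safe_Answered safe_Inner)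
    then show ?thesis using Until.IH(1)[of l i'' k'] m(4) i'(1) sub by auto
  qed
  ultimately show ?case using i'(2) by auto
qed

text \<open>Provides Duplicator's replies for an entire round: \<open>n\<close> answers
  \<open>m\<close>, and \<open>m'\<close> answers an inner challenge \<open>n'\<close>.\<close>

lemma mtl_equiv_Suc_answer:
  fixes v w :: "'p::finite data_word"
  assumes "\<I> \<in> FCons" "mtl_equiv \<I> (Suc k) v i w j" "i < m"
  obtains n where "j < n" "same_region \<I> (datum_diff v i m) (datum_diff w j n)"
    "mtl_equiv \<I> k v m w n"
    "\<And>n'. j < n' \<Longrightarrow> n' < n \<Longrightarrow> \<exists>m'. i < m' \<and> m' < m \<and> mtl_equiv \<I> k v m' w n'"
proof -
  have "finite \<I>" using assms(1) unfolding FCons_def by auto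
  then obtain type where type: "\<And>m. type m \<in> MTL \<I> k"
    "\<And>m w' i'. sat w' i' (type m) \<longleftrightarrow> mtl_equiv \<I> k v m w' i'"
    using ex_type_formula[of \<I> k v] by metis
  \<comment> \<open>If \<open>m = Suc i\<close> the disjunction is empty, hence false, and forces
    \<open>n = Suc j\<close>.\<close>
  have "type ` {i<..<m} \<subseteq> MTL \<I> k" using type(1) by auto
  from ex_big_disj[OF _ this] obtain \<phi> where
    \<phi>: "\<phi> \<in> MTL \<I> k" "\<And>w' i'. sat w' i' \<phi> \<longleftrightarrow> (\<exists>m'\<in>{i<..<m}. mtl_equiv \<I> k v m' w' i')"
    by (auto simp: type(2))
  obtain J where J: "endpoints J \<subseteq> \<I>" "datum_diff v i m \<in> ints_in J"
    "\<And>e. e \<in> ints_in J \<Longrightarrow> same_region \<I> (datum_diff v i m) e"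
    using ex_region_interval[OF assms(1)] by blast
  \<comment> \<open>The witness is \<open>m\<close> itself, as every position satisfies its own type
    formula.\<close>
  have "sat v i (Until \<phi> J (type m))"
    using assms(3) J(2) by (auto simp: type(2) \<phi>(2) intro!: exI[of _ m] intro: mtl_equiv_refl)
  moreover have "Until \<phi> J (type m) \<in> MTL \<I> (Suc k)"
    using \<phi>(1) J(1) type(1)[of m] by (auto simp: MTL_def)
  ultimately have "sat w j (Until \<phi> J (type m))" using assms(2) unfolding mtl_equiv_def by blast
  then obtain n where "j < n" "mtl_equiv \<I> k v m w n" "datum_diff w j n \<in> ints_in J"
    "\<And>n'. j < n' \<Longrightarrow> n' < n \<Longrightarrow> \<exists>m'\<in>{i<..<m}. mtl_equiv \<I> k v m' w n'"
    by (auto simp: type(2) \<phi>(2))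
  then show thesis using J(3) by (intro that[of n]) (simp_all add: Bex_def conj_assoc)
qed

lemma mtl_equiv_imp_agree:
  assumes "mtl_equiv \<I> k (w False) (i False) (w True) (i True)"
  shows "agree w i"
proof -
  have "sat (w False) (i False) (Prop p) \<longleftrightarrow> sat (w True) (i True) (Prop p)" for p
    using assms unfolding mtl_equiv_def by (rule bspec) (simp add: MTL_def)
  then show ?thesis by (auto simp: agree_def)
qed

lemma mtl_equiv_imp_safe:
  fixes w :: "bool \<Rightarrow> 'p::finite data_word"
  assumes "\<I> \<in> FCons" "mtl_equiv \<I> k (w False) (i False) (w True) (i True)"
  shows "safe \<I> w (Round k i)"
  using assms(2)
proof (induction k arbitrary: i)
  case 0
  then show ?case by (simp add: safe_Round_0 mtl_equiv_imp_agree)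
next
  case (Suc k)
  \<comment> \<open>The induction hypothesis for a pair of positions given in the order
    \<open>l\<close>, \<open>\<not> l\<close>.\<close>
  have IH: "safe \<I> w (Round k (\<lambda>b. if b = l then a else c))"
    if "mtl_equiv \<I> k (w l) a (w (\<not> l)) c" for l a c
    by (rule Suc.IH, subst mtl_equiv_bool[where l = l]) (use that in simp)
  have "safe \<I> w (Picked k i l m)" if m: "i l < m" for l m
  proof -
    have "mtl_equiv \<I> (Suc k) (w l) (i l) (w (\<not> l)) (i (\<not> l))"
      using Suc.prems mtl_equiv_bool[of \<I> "Suc k" w i l] by simp
    from mtl_equiv_Suc_answer[OF assms(1) this m] obtain n where n: "i (\<not> l) < n"
      "same_region \<I> (datum_diff (w l) (i l) m) (datum_diff (w (\<not> l)) (i (\<not> l)) n)"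
      "mtl_equiv \<I> k (w l) m (w (\<not> l)) n"
      "\<And>n'. i (\<not> l) < n' \<Longrightarrow> n' < n \<Longrightarrow>
        \<exists>m'. i l < m' \<and> m' < m \<and> mtl_equiv \<I> k (w l) m' (w (\<not> l)) n'"
      by blast
    define i' where "i' = (\<lambda>b. if b = l then m else n)"
    have "safe \<I> w (Inner k i l i' n')" if "i (\<not> l) < n'" "n' < i' (\<not> l)" for n'
    proof -
      obtain m' where "i l < m'" "m' < m" "mtl_equiv \<I> k (w l) m' (w (\<not> l)) n'"
        using n(4) \<open>i (\<not> l) < n'\<close> \<open>n' < i' (\<not> l)\<close> by (auto simp: i'_def)
      then show ?thesis
        unfolding safe_Inner using IH
        by (intro exI[of _ "\<lambda>b. if b = l then m' else n'"]) (simp add: i'_def)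
    qed
    then have "safe \<I> w (Answered k i l i')" using IH[OF n(3)] by (simp add: safe_Answered i'_def)
    moreover have "same_region \<I> (datum_diff (w False) (i False) (i' False))
        (datum_diff (w True) (i True) (i' True))"
      using n(2) same_region_bool[of \<I> "\<lambda>b. datum_diff (w b) (i b) (i' b)" l]
      by (simp add: i'_def)
    ultimately show ?thesis
      unfolding safe_Picked using n(1) by (intro exI[of _ i']) (simp add: i'_def)
  qed
  then show ?case using Suc.prems by (simp add: safe_Round_Suc mtl_equiv_imp_agree)
qed

theorem theorem1:
  fixes \<I> :: "int extended set" and k :: nat
    and w\<^sub>0 w\<^sub>1 :: "('p::finite) data_word" and i\<^sub>0 i\<^sub>1 :: nat
  assumes "\<I> \<in> FCons"
  shows "(\<forall>\<phi> \<in> MTL \<I> k. sat w\<^sub>0 i\<^sub>0 \<phi> \<longleftrightarrow> sat w\<^sub>1 i\<^sub>1 \<phi>) \<longleftrightarrow>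
         duplicator_wins_MG \<I> k w\<^sub>0 i\<^sub>0 w\<^sub>1 i\<^sub>1"
proof -
  let ?w = "\<lambda>l. if l then w\<^sub>1 else w\<^sub>0" and ?i = "\<lambda>l. if l then i\<^sub>1 else i\<^sub>0"
  have "mtl_equiv \<I> k w\<^sub>0 i\<^sub>0 w\<^sub>1 i\<^sub>1 \<longleftrightarrow> safe \<I> ?w (Round k ?i)"
  proof
    show "safe \<I> ?w (Round k ?i)" if "mtl_equiv \<I> k w\<^sub>0 i\<^sub>0 w\<^sub>1 i\<^sub>1"
      using mtl_equiv_imp_safe[OF assms, of k ?w ?i] that by simp
    show "mtl_equiv \<I> k w\<^sub>0 i\<^sub>0 w\<^sub>1 i\<^sub>1" if "safe \<I> ?w (Round k ?i)"
      \<comment> \<open>The two values of \<open>l\<close> give the two implications.\<close>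
      using safe_imp_sat[OF that, of _ False] safe_imp_sat[OF that, of _ True]
      by (auto simp: mtl_equiv_def)
  qed
  then show ?thesis
    by (simp add: mtl_equiv_def duplicator_wins_MG_def ex_winning_strategy_iff_safe)
qed

end
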